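(* Let $\mathcal C$ be a finite set, let $M\ge 1$ be an integer, and for each $m\in\{1,\ldots,M\}$ let $r_m:\mathcal C\to[0,1]$ be a fixed function. Define the set function $A_{\mathrm{SC}}:2^{\mathcal C}\to[0,1]$ by $$A_{\mathrm{SC}}(\mathcal B)=\frac1M\sum_{m=1}^{M}\left[1-\prod_{x\in\mathcal B}\bigl(1-r_m(x)\bigr)\right],\qquad \mathcal B\subseteq\mathcal C.$$ Then $A_{\mathrm{SC}}$ is normalized, monotone, and submodular.
   Context: $\mathcal C$ is a finite pool of candidate designs, and $r_m(x)\in[0,1]$ is the response of candidate $x$ under predictive scenario $m$; the responses are fixed numbers (all data, candidates, scenarios and responses are conditioned upon). Empty products equal $1$. For a set function $A:2^{\mathcal C}\to\mathbb R$: normalized means $A(\varnothing)=0$; monotone means $A(\mathcal S)\le A(\mathcal T)$ whenever $\mathcal S\subseteq\mathcal T\subseteq\mathcal C$; submodular means $A(\mathcal S\cup\{x\})-A(\mathcal S)\ge A(\mathcal T\cup\{x\})-A(\mathcal T)$ whenever $\mathcal S\subseteq\mathcal T\subseteq\mathcal C$ and $x\in\mathcal C\setminus\mathcal T$. *)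

theory Defs
  imports Complex_Main "HOL-Library.FuncSet"
begin

text \<open>
  A set function on the subsets of a ground set \<open>C\<close> is a total function \<open>'a set \<Rightarrow> real\<close> of which
  only the values on \<open>Pow C\<close> matter. Monotonicity with respect to inclusion is then
  \<open>mono_on (Pow C) A\<close>, the order on sets being \<open>\<subseteq>\<close>.
\<close>

definition normalized :: "('a set \<Rightarrow> real) \<Rightarrow> bool" where
  "normalized A \<longleftrightarrow> A {} = 0"

definition submodular_on :: "'a set \<Rightarrow> ('a set \<Rightarrow> real) \<Rightarrow> bool" where
  "submodular_on C A \<longleftrightarrow>
     (\<forall>S T x. S \<subseteq> T \<longrightarrow> T \<subseteq> C \<longrightarrow> x \<in> C - T \<longrightarrow>
        A (S \<union> {x}) - A S \<ge> A (T \<union> {x}) - A T)"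

definition A_SC :: "nat \<Rightarrow> (nat \<Rightarrow> 'a \<Rightarrow> real) \<Rightarrow> 'a set \<Rightarrow> real" where
  "A_SC M r B = 1 / real M * (\<Sum>m=1..M. 1 - (\<Prod>x\<in>B. 1 - r m x))"

end

theory Submission
  imports Defs
begin

text \<open>
  The product \<open>\<Prod>x\<in>B. 1 - r m x\<close> is the fraction that scenario \<open>m\<close> leaves uncovered
  by \<open>B\<close>. Its factors lie in \<open>[0,1]\<close>, so it starts at 1, stays in \<open>[0,1]\<close>, and can only shrink
  as \<open>B\<close> grows (lemma \<open>prod_antimono_set\<close>). The first fact gives normalization, the second the
  range, and the third monotonicity. The third also gives submodularity: adding \<open>x\<close> multiplies
  the uncovered fraction by \<open>1 - r m x\<close>, so the gain is the average of \<open>r m x\<close> times the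
  fraction still uncovered (lemma \<open>A_SC_marginal_gain\<close>), and a larger set leaves less to gain.
\<close>

text \<open>
  The product over the larger set is the one over the smaller set times the remaining factors,
  whose product is at most 1.
\<close>
lemma prod_antimono_set:
  fixes f :: "'a \<Rightarrow> 'b::linordered_idom"
  assumes "finite T" "S \<subseteq> T" and unit: "\<And>x. x \<in> T \<Longrightarrow> 0 \<le> f x \<and> f x \<le> 1"
  shows "prod f T \<le> prod f S"
proof -
  have "prod f T = prod f (T - S) * prod f S"
    using assms(1,2) by (simp add: prod.subset_diff)
  also have "\<dots> \<le> 1 * prod f S"
    using assms by (intro mult_right_mono prod_le_1 prod_nonneg) auto
  finally show ?thesis by simp
qed

lemma A_SC_marginal_gain:
  assumes "finite S" "x \<notin> S"
  shows "A_SC M r (S \<union> {x}) - A_SC M r S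
    = 1 / real M * (\<Sum>m=1..M. r m x * (\<Prod>y\<in>S. 1 - r m y))"
proof -
  have "A_SC M r (S \<union> {x}) - A_SC M r S
      = 1 / real M * (\<Sum>m=1..M. (1 - (\<Prod>y\<in>insert x S. 1 - r m y)) - (1 - (\<Prod>y\<in>S. 1 - r m y)))"
    by (simp add: A_SC_def sum_subtractf right_diff_distrib)
  also have "\<dots> = 1 / real M * (\<Sum>m=1..M. r m x * (\<Prod>y\<in>S. 1 - r m y))"
    using assms by (simp add: algebra_simps)
  finally show ?thesis .
qed

theorem proposition1:
  fixes C :: "'a set" and M :: nat and r :: "nat \<Rightarrow> 'a \<Rightarrow> real"
  assumes "finite C"
    and "M \<ge> 1"
    and "\<And>m. m \<in> {1..M} \<Longrightarrow> r m \<in> C \<rightarrow> {0..1}"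
  shows "A_SC M r \<in> Pow C \<rightarrow> {0..1} \<and>
    normalized (A_SC M r) \<and> mono_on (Pow C) (A_SC M r) \<and> submodular_on C (A_SC M r)"
proof -
  have fin: "finite B" if "B \<subseteq> C" for B
    using that assms(1) by (rule finite_subset)
  have r_unit: "0 \<le> r m x \<and> r m x \<le> 1" if "m \<in> {1..M}" "x \<in> C" for m x
    using assms(3)[OF that(1)] that(2) by (auto simp: Pi_iff)
  have uncovered_antimono: "(\<Prod>x\<in>T. 1 - r m x) \<le> (\<Prod>x\<in>S. 1 - r m x)"
    if "m \<in> {1..M}" "S \<subseteq> T" "T \<subseteq> C" for m S T
    using that r_unit by (intro prod_antimono_set fin) auto
  have normalized: "A_SC M r {} = 0"
    by (simp add: A_SC_def)
  have mono: "A_SC M r S \<le> A_SC M r T" if "S \<subseteq> T" "T \<subseteq> C" for S T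
    unfolding A_SC_def using uncovered_antimono that
    by (intro mult_left_mono sum_mono) auto
  have le_1: "A_SC M r B \<le> 1" if "B \<subseteq> C" for B
  proof -
    have "(\<Prod>x\<in>B. 1 - r m x) \<ge> 0" if "m \<in> {1..M}" for m
      using r_unit[OF that] \<open>B \<subseteq> C\<close> by (intro prod_nonneg) auto
    then have "(\<Sum>m=1..M. 1 - (\<Prod>x\<in>B. 1 - r m x)) \<le> (\<Sum>m=1..M. 1)"
      by (intro sum_mono) auto
    then show ?thesis
      using assms(2) by (simp add: A_SC_def divide_le_eq)
  qed
  have range: "A_SC M r B \<in> {0..1}" if "B \<subseteq> C" for B
    using mono[of "{}" B] le_1 normalized that by simp
  have submodular: "A_SC M r (T \<union> {x}) - A_SC M r T \<le> A_SC M r (S \<union> {x}) - A_SC M r S"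
    if "S \<subseteq> T" "T \<subseteq> C" "x \<in> C - T" for S T x
  proof -
    have "(\<Sum>m=1..M. r m x * (\<Prod>y\<in>T. 1 - r m y)) \<le> (\<Sum>m=1..M. r m x * (\<Prod>y\<in>S. 1 - r m y))"
      using that r_unit uncovered_antimono by (intro sum_mono mult_left_mono) auto
    then have "1 / real M * (\<Sum>m=1..M. r m x * (\<Prod>y\<in>T. 1 - r m y))
        \<le> 1 / real M * (\<Sum>m=1..M. r m x * (\<Prod>y\<in>S. 1 - r m y))"
      by (intro mult_left_mono) auto
    moreover have "finite S" "finite T" "x \<notin> S" "x \<notin> T"
      using that fin[of S] fin[of T] by auto
    ultimately show ?thesis
      by (simp only: A_SC_marginal_gain not_False_eq_True)
  qed
  show ?thesis
    using normalized mono range submodular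
    by (auto simp: normalized_def submodular_on_def intro!: mono_onI)
qed

end
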